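(* Let $\mathcal M=(M,<,0,+,\ldots)$ be a definably complete locally o-minimal expansion of an ordered group having definable bounded multiplication $\cdot$ compatible to $+$, and let $\Phi$ be a fixed admissible subgroup of $\Phi_0(M)$ (see context). Let $S$ be a definable, closed and bounded subset of $M^n$. Let $f,g:S\to M$ be definable continuous functions with $f^{-1}(0)\subseteq g^{-1}(0)$. Then there exist $\phi\in\Phi$ and a positive $N\in M$ such that $$|\phi(g(x))|\le N|f(x)|$$ for all $x\in S$. In addition, when $\mathcal M$ is polynomially bounded, there exist a positive integer $m$ and a positive $N\in M$ such that $$|g(x)|^m\le N|f(x)|$$ for all $x\in S$.
   Context: "Definable" means definable in $\mathcal M$ with parameters; $M$ has the order topology and $M^n$ the product topology. An open interval is $(a,b)=\{x\in M: a<x<b\}$, $a<b$ in $M$. Locally o-minimal: for every definable $X\subseteq M$ and $a\in M$ there is an open interval $I\ni a$ such that $X\cap I$ is a finite union of points and open intervals. Definably complete: every definable subset of $M$ has a supremum and an infimum in $M\cup\{\pm\infty\}$. An expansion $\mathcal M=(M,<,0,+,\ldots)$ of a densely linearly ordered group has definable bounded multiplication compatible to $+$ if there exist an element $1\in M$ and a map $\cdot:M\times M\to M$ such that (1) $(M,<,0,1,+,\cdot)$ is an ordered field, and (2) for every bounded open interval $I$, the restriction $\cdot|_{I\times I}$ is definable in $\mathcal M$. Products and powers below are taken with respect to this $\cdot$. $\Phi_0(M)$ denotes the set of all odd strictly increasing definable bijections from $M$ onto $M$ fixing $0$; it is a group under composition. A subgroup $\Phi\subseteq\Phi_0(M)$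 is called admissible here if: for any positive $a\in M$ and any definable continuous strictly increasing $f:[0,a]\to M$ with $f(0)=0$, there are $\varphi,\psi\in\Phi$ such that $f(t)\le\varphi(t)$ and $\psi(t)\le f(t)$ for all sufficiently small $t>0$. $\mathcal M$ is polynomially bounded if for any positive $a\in M$ and any definable continuous strictly increasing $f:[0,a]\to M$ with $f(0)=0$ there exists a positive integer $m$ such that $f(t)\ge t^m$ for all sufficiently small $t>0$. *)

theory Defs
  imports "HOL-Analysis.Analysis" "HOL-Algebra.Group" "HOL-Library.Extended" "HOL-Library.Lub_Glb"
begin

text \<open>First-order syntax over \<open><, 0, +\<close> and further function symbols \<open>'f\<close> and
  relation symbols \<open>'r\<close>. No arities are declared: a symbol applied to \<open>k\<close> arguments is read as
  a \<open>k\<close>-ary symbol, so one element of \<open>'f\<close> or \<open>'r\<close> stands for one symbol of every arity.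
  Symbols that a given language lacks can be interpreted trivially.\<close>

datatype 'f fo_term =
    Var nat
  | Zero
  | Plus "'f fo_term" "'f fo_term"
  | Fn 'f "'f fo_term list"

datatype ('f, 'r) fo_formula =
    Eq "'f fo_term" "'f fo_term"
  | Less "'f fo_term" "'f fo_term"
  | Rel 'r "'f fo_term list"
  | Neg "('f, 'r) fo_formula"
  | Conj "('f, 'r) fo_formula" "('f, 'r) fo_formula"
  | Exists nat "('f, 'r) fo_formula"

text \<open>The universe is the whole type \<open>'a\<close>; \<open><, 0, +\<close> are those of its type class, and the record
  interprets the remaining symbols.\<close>

record ('a, 'f, 'r) expansion =
  fun_interp :: "'f \<Rightarrow> 'a list \<Rightarrow> 'a"
  rel_interp :: "'r \<Rightarrow> 'a list \<Rightarrow> bool"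

primrec term_val ::
  "('a::linordered_ab_group_add, 'f, 'r) expansion \<Rightarrow> (nat \<Rightarrow> 'a) \<Rightarrow> 'f fo_term \<Rightarrow> 'a" where
  "term_val M e (Var i) = e i"
| "term_val M e Zero = 0"
| "term_val M e (Plus s t) = term_val M e s + term_val M e t"
| "term_val M e (Fn c ts) = fun_interp M c (map (term_val M e) ts)"

primrec sat ::
  "('a::linordered_ab_group_add, 'f, 'r) expansion \<Rightarrow> (nat \<Rightarrow> 'a) \<Rightarrow> ('f, 'r) fo_formula \<Rightarrow> bool" where
  "sat M e (Eq s t) \<longleftrightarrow> term_val M e s = term_val M e t"
| "sat M e (Less s t) \<longleftrightarrow> term_val M e s < term_val M e t"
| "sat M e (Rel R ts) \<longleftrightarrow> rel_interp M R (map (term_val M e) ts)"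
| "sat M e (Neg p) \<longleftrightarrow> \<not> sat M e p"
| "sat M e (Conj p q) \<longleftrightarrow> sat M e p \<and> sat M e q"
| "sat M e (Exists i p) \<longleftrightarrow> (\<exists>a. sat M (e(i := a)) p)"

text \<open>Points of \<open>M\<^sup>n\<close> are the extensional functions on \<open>{..<n}\<close>, the carrier of the library's
  product topology.\<close>

abbreviation cart :: "nat \<Rightarrow> (nat \<Rightarrow> 'a) set" where
  "cart n \<equiv> {..<n} \<rightarrow>\<^sub>E UNIV"

abbreviation cart_topology :: "nat \<Rightarrow> (nat \<Rightarrow> 'a::topological_space) topology" where
  "cart_topology n \<equiv> product_topology (\<lambda>_. euclidean) {..<n}"

text \<open>The variables below \<open>n\<close> hold the coordinates of the point; the other variables are
  assigned by \<open>e\<close>, which supplies the parameters.\<close>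

definition definable ::
  "('a::linordered_ab_group_add, 'f, 'r) expansion \<Rightarrow> nat \<Rightarrow> (nat \<Rightarrow> 'a) set \<Rightarrow> bool" where
  "definable M n X \<longleftrightarrow> (\<exists>p e. X = {x \<in> cart n. sat M (\<lambda>i. if i < n then x i else e i) p})"

text \<open>A map on \<open>S \<subseteq> M\<^sup>n\<close> is definable if its graph, a subset of \<open>M\<^sup>n\<^sup>+\<^sup>1\<close>, is.\<close>

definition definable_map ::
  "('a::linordered_ab_group_add, 'f, 'r) expansion \<Rightarrow> nat \<Rightarrow> (nat \<Rightarrow> 'a) set
    \<Rightarrow> ((nat \<Rightarrow> 'a) \<Rightarrow> 'a) \<Rightarrow> bool" where
  "definable_map M n S f \<longleftrightarrow> definable M (Suc n) ((\<lambda>x. x(n := f x)) ` S)"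

text \<open>Subsets of \<open>M\<close> and unary maps, via the identification of \<open>M\<close> with \<open>M\<^sup>1\<close>.\<close>

definition definable1 :: "('a::linordered_ab_group_add, 'f, 'r) expansion \<Rightarrow> 'a set \<Rightarrow> bool" where
  "definable1 M X \<longleftrightarrow> definable M 1 {x \<in> cart 1. x 0 \<in> X}"

definition definable_map1 ::
  "('a::linordered_ab_group_add, 'f, 'r) expansion \<Rightarrow> 'a set \<Rightarrow> ('a \<Rightarrow> 'a) \<Rightarrow> bool" where
  "definable_map1 M X f \<longleftrightarrow> definable_map M 1 {x \<in> cart 1. x 0 \<in> X} (\<lambda>x. f (x 0))"

definition locally_o_minimal ::
  "('a::linordered_ab_group_add, 'f, 'r) expansion \<Rightarrow> bool" where
  "locally_o_minimal M \<longleftrightarrow>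
    (\<forall>X a. definable1 M X \<longrightarrow>
      (\<exists>b c P \<J>. b < a \<and> a < c \<and> finite P \<and> finite \<J>
        \<and> (\<forall>J\<in>\<J>. \<exists>p q. p < q \<and> J = {p<..<q})
        \<and> X \<inter> {b<..<c} = P \<union> \<Union>\<J>))"

text \<open>The type \<open>'a extended\<close> is \<open>M \<union> {\<plusminus>\<infinity>}\<close>.\<close>

definition definably_complete ::
  "('a::linordered_ab_group_add, 'f, 'r) expansion \<Rightarrow> bool" where
  "definably_complete M \<longleftrightarrow>
    (\<forall>X. definable1 M X \<longrightarrow>
      (\<exists>s :: 'a extended. isLub UNIV (Fin ` X) s) \<and>
      (\<exists>i :: 'a extended. isGlb UNIV (Fin ` X) i))"

text \<open>The field structure \<open>(M, <, 0, 1, +, \<cdot>)\<close> is carried by the type class; multiplication is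
  not one of the symbols of the language, and only its restrictions to bounded squares are
  required to be definable.\<close>

definition definable_bounded_mult ::
  "('a::linordered_field, 'f, 'r) expansion \<Rightarrow> bool" where
  "definable_bounded_mult M \<longleftrightarrow>
    (\<forall>a b. a < b \<longrightarrow>
      definable_map M 2 ({..<2} \<rightarrow>\<^sub>E {a<..<b}) (\<lambda>x. x 0 * x 1))"

definition bounded_cart :: "nat \<Rightarrow> (nat \<Rightarrow> 'a::linordered_ab_group_add) set \<Rightarrow> bool" where
  "bounded_cart n S \<longleftrightarrow> (\<exists>a b. \<forall>x\<in>S. \<forall>i<n. a \<le> x i \<and> x i \<le> b)"

definition definable_increasing ::
  "('a::{linordered_ab_group_add, linorder_topology}, 'f, 'r) expansion
    \<Rightarrow> 'a \<Rightarrow> ('a \<Rightarrow> 'a) \<Rightarrow> bool" where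
  "definable_increasing M a f \<longleftrightarrow>
    definable_map1 M {0..a} f \<and> continuous_on {0..a} f \<and> strict_mono_on {0..a} f \<and> f 0 = 0"

definition polynomially_bounded ::
  "('a::{linordered_field, linorder_topology}, 'f, 'r) expansion \<Rightarrow> bool" where
  "polynomially_bounded M \<longleftrightarrow>
    (\<forall>a f. 0 < a \<longrightarrow> definable_increasing M a f \<longrightarrow>
      (\<exists>m::nat. 0 < m \<and> (\<forall>\<^sub>F t in at_right 0. f t \<ge> t ^ m)))"

definition Phi0 :: "('a::linordered_ab_group_add, 'f, 'r) expansion \<Rightarrow> ('a \<Rightarrow> 'a) set" where
  "Phi0 M = {\<phi>. definable_map1 M UNIV \<phi> \<and> bij \<phi> \<and> strict_mono \<phi>
                \<and> (\<forall>x. \<phi> (- x) = - \<phi> x) \<and> \<phi> 0 = 0}"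

definition Phi0_group :: "('a::linordered_ab_group_add, 'f, 'r) expansion \<Rightarrow> ('a \<Rightarrow> 'a) monoid" where
  "Phi0_group M = \<lparr>carrier = Phi0 M, monoid.mult = (\<circ>), one = id\<rparr>"

definition admissible ::
  "('a::{linordered_ab_group_add, linorder_topology}, 'f, 'r) expansion
    \<Rightarrow> ('a \<Rightarrow> 'a) set \<Rightarrow> bool" where
  "admissible M \<Phi> \<longleftrightarrow>
    subgroup \<Phi> (Phi0_group M) \<and>
    (\<forall>a f. 0 < a \<longrightarrow> definable_increasing M a f \<longrightarrow>
      (\<exists>\<phi>\<in>\<Phi>. \<exists>\<psi>\<in>\<Phi>. \<forall>\<^sub>F t in at_right 0. f t \<le> \<phi> t \<and> \<psi> t \<le> f t))"

end

theory Submission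
  imports Defs
begin

text \<open>Let \<open>k t\<close> be the minimum over \<open>x \<in> S\<close> of \<open>\<bar>f x\<bar> + max (t - \<bar>g x\<bar>) 0\<close>. The minimum exists because, by
  definable completeness, definable continuous functions attain their extrema on closed bounded
  definable sets. Taking \<open>t = \<bar>g x\<bar>\<close> gives \<open>k \<bar>g x\<bar> \<le> \<bar>f x\<bar>\<close>; moreover \<open>k\<close> is nondecreasing and
  nonexpansive, and \<open>k t > 0\<close> for \<open>t > 0\<close> by the hypothesis on the zero sets. So \<open>t * k t\<close> is definable,
  continuous and strictly increasing on \<open>[0, 1]\<close>, and admissibility or polynomial boundedness
  bounds it below near \<open>0\<close>. Away from the zeros of \<open>g\<close>, \<open>\<bar>f\<bar>\<close> is bounded below and \<open>g\<close> is bounded.\<close>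

section \<open>Definable predicates and functions\<close>

primrec rename_term :: "(nat \<Rightarrow> nat) \<Rightarrow> 'f fo_term \<Rightarrow> 'f fo_term" where
  "rename_term \<tau> (Var i) = Var (\<tau> i)"
| "rename_term \<tau> Zero = Zero"
| "rename_term \<tau> (Plus s t) = Plus (rename_term \<tau> s) (rename_term \<tau> t)"
| "rename_term \<tau> (Fn c ts) = Fn c (map (rename_term \<tau>) ts)"

lemma term_val_rename: "term_val M e (rename_term \<tau> t) = term_val M (\<lambda>i. e (\<tau> i)) t"
  by (induction t) (auto simp: o_def cong: map_cong)

text \<open>A semantic substitute for the set of free variables. An upper bound suffices, since it
  serves only to find a fresh variable when a renaming passes a quantifier.\<close>

definition depends_below :: "nat \<Rightarrow> ((nat \<Rightarrow> 'a) \<Rightarrow> 'b) \<Rightarrow> bool" where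
  "depends_below N F \<longleftrightarrow> (\<forall>e e'. (\<forall>i<N. e i = e' i) \<longrightarrow> F e = F e')"

lemma depends_belowI:
  "(\<And>e e'. (\<And>i. i < N \<Longrightarrow> e i = e' i) \<Longrightarrow> F e = F e') \<Longrightarrow> depends_below N F"
  unfolding depends_below_def by blast

lemma depends_belowD:
  "depends_below N F \<Longrightarrow> (\<And>i. i < N \<Longrightarrow> e i = e' i) \<Longrightarrow> F e = F e'"
  unfolding depends_below_def by blast

lemma depends_below_comp:
  assumes "depends_below N F"
  shows "depends_below N (\<lambda>e. h (F e))"
proof (rule depends_belowI)
  fix e e' :: "nat \<Rightarrow> 'a" assume "\<And>i. i < N \<Longrightarrow> e i = e' i"
  then have "F e = F e'" by (rule depends_belowD[OF assms])
  then show "h (F e) = h (F e')" by simp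
qed

lemma depends_below_comp2:
  assumes "depends_below N F" "depends_below N G"
  shows "depends_below N (\<lambda>e. h (F e) (G e))"
proof (rule depends_belowI)
  fix e e' :: "nat \<Rightarrow> 'a" assume eq: "\<And>i. i < N \<Longrightarrow> e i = e' i"
  have "F e = F e'" using eq by (rule depends_belowD[OF assms(1)])
  moreover have "G e = G e'" using eq by (rule depends_belowD[OF assms(2)])
  ultimately show "h (F e) (G e) = h (F e') (G e')" by simp
qed

lemma depends_below_map:
  assumes "\<forall>t\<in>set ts. depends_below N (\<lambda>e. F e t)"
  shows "depends_below N (\<lambda>e. map (F e) ts)"
proof (rule depends_belowI)
  fix e e' :: "nat \<Rightarrow> 'b" assume eq: "\<And>i. i < N \<Longrightarrow> e i = e' i"
  have "F e t = F e' t" if "t \<in> set ts" for t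
    using eq by (rule depends_belowD[OF bspec[OF assms that]])
  then show "map (F e) ts = map (F e') ts" by simp
qed

text \<open>Stated for all large \<open>N\<close>, so that the bounds of finitely many subterms
  combine without explicit maxima.\<close>

lemma term_val_finite_support: "\<forall>\<^sub>F N in sequentially. depends_below N (\<lambda>e. term_val M e t)"
proof (induction t)
  case (Var i)
  show ?case
    using eventually_gt_at_top[of i] by eventually_elim (simp add: depends_below_def)
next
  case Zero
  show ?case by (simp add: depends_below_def)
next
  case (Plus s t)
  then show ?case
    unfolding term_val.simps by eventually_elim (rule depends_below_comp2[where h = "(+)"])
next
  case (Fn c ts)
  then have "\<forall>\<^sub>F N in sequentially. \<forall>t\<in>set ts. depends_below N (\<lambda>e. term_val M e t)"
    by (intro eventually_ball_finite) auto
  then show ?case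
    unfolding term_val.simps
    by eventually_elim (rule depends_below_comp[where h = "fun_interp M c", OF depends_below_map])
qed

lemma sat_finite_support: "\<forall>\<^sub>F N in sequentially. depends_below N (\<lambda>e. sat M e p)"
proof (induction p)
  case (Eq s t)
  show ?case
    using term_val_finite_support[of M s] term_val_finite_support[of M t]
    unfolding sat.simps by eventually_elim (rule depends_below_comp2[where h = "(=)"])
next
  case (Less s t)
  show ?case
    using term_val_finite_support[of M s] term_val_finite_support[of M t]
    unfolding sat.simps by eventually_elim (rule depends_below_comp2[where h = "(<)"])
next
  case (Rel R ts)
  have "\<forall>\<^sub>F N in sequentially. \<forall>t\<in>set ts. depends_below N (\<lambda>e. term_val M e t)"
    using term_val_finite_support by (intro eventually_ball_finite) auto
  then show ?case
    unfolding sat.simps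
    by eventually_elim (rule depends_below_comp[where h = "rel_interp M R", OF depends_below_map])
next
  case (Neg p)
  then show ?case
    unfolding sat.simps by eventually_elim (rule depends_below_comp[where h = Not])
next
  case (Conj p q)
  then show ?case
    unfolding sat.simps by eventually_elim (rule depends_below_comp2[where h = "(\<and>)"])
next
  case (Exists k p)
  then show ?case
    unfolding sat.simps
  proof eventually_elim
    case (elim N)
    \<comment> \<open>Updating both environments at \<open>k\<close> by the same value keeps them
      equal below \<open>N\<close>, so the bound for \<open>p\<close> also serves the quantified
      formula.\<close>
    show ?case
      by (intro depends_belowI ex_cong1 depends_belowD[OF elim]) simp
  qed
qed

text \<open>\<open>\<tau>\<close> need not be injective, so a naive renaming could capture
  variables. Bound variables are therefore moved to fresh ones, which changes \<open>\<tau>\<close>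
  and forces the induction to be over all renamings.\<close>

lemma sat_rename: "\<exists>q. \<forall>e. sat M e q = sat M (\<lambda>i. e (\<tau> i)) p"
proof (induction p arbitrary: \<tau>)
  case (Eq s t)
  show ?case
    by (rule exI[of _ "Eq (rename_term \<tau> s) (rename_term \<tau> t)"]) (simp add: term_val_rename)
next
  case (Less s t)
  show ?case
    by (rule exI[of _ "Less (rename_term \<tau> s) (rename_term \<tau> t)"]) (simp add: term_val_rename)
next
  case (Rel R ts)
  show ?case
    by (rule exI[of _ "Rel R (map (rename_term \<tau>) ts)"]) (simp add: term_val_rename o_def)
next
  case (Neg p)
  then obtain q where "\<forall>e. sat M e q = sat M (\<lambda>i. e (\<tau> i)) p" by blast
  then show ?case by (intro exI[of _ "Neg q"]) simp
next
  case (Conj p p')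
  obtain q where "\<forall>e. sat M e q = sat M (\<lambda>i. e (\<tau> i)) p" using Conj(1) by blast
  moreover obtain q' where "\<forall>e. sat M e q' = sat M (\<lambda>i. e (\<tau> i)) p'" using Conj(2) by blast
  ultimately show ?case by (intro exI[of _ "Conj q q'"]) simp
next
  case (Exists j p)
  obtain N where N: "depends_below N (\<lambda>e. sat M e p)"
    using eventually_happens[OF sat_finite_support[of M p]] by auto
  obtain k where k: "k \<notin> \<tau> ` {..<N}"
    using ex_new_if_finite[of "\<tau> ` {..<N}"] infinite_UNIV_nat by auto
  obtain q where q: "\<forall>e. sat M e q = sat M (\<lambda>i. e ((\<tau>(j := k)) i)) p"
    using Exists by blast
  \<comment> \<open>Above \<open>N\<close> the renaming may well hit \<open>k\<close>, so the two
    environments need agree only below \<open>N\<close>, which is all that \<open>p\<close>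
    sees.\<close>
  have "sat M (e(k := a)) q = sat M ((\<lambda>i. e (\<tau> i))(j := a)) p" for e a
    unfolding q[rule_format] using k by (intro depends_belowD[OF N]) auto
  then show ?case by (intro exI[of _ "Exists k q"]) simp
qed

text \<open>\<open>assign u v\<close> gives the variable \<open>i\<close> of a formula either a coordinate of \<open>v\<close> (\<open>u i = Inl j\<close>) or a
  parameter (\<open>u i = Inr c\<close>). Hence \<open>definable_pred\<close> is definability with parameters for predicates on
  infinite environments. It is stable under any identification of variables, so that quantifiers can be
  treated as with de Bruijn indices: the bound variable is \<open>v 0\<close> and the others are shifted.\<close>

definition assign :: "(nat \<Rightarrow> nat + 'a) \<Rightarrow> (nat \<Rightarrow> 'a) \<Rightarrow> nat \<Rightarrow> 'a" where
  "assign u v i = case_sum v id (u i)"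

definition definable_pred ::
  "('a::linordered_ab_group_add, 'f, 'r) expansion \<Rightarrow> ((nat \<Rightarrow> 'a) \<Rightarrow> bool) \<Rightarrow> bool" where
  "definable_pred M P \<longleftrightarrow> (\<exists>p u. \<forall>v. P v = sat M (assign u v) p)"

lemma definable_predI: "(\<And>v. P v = sat M (assign u v) p) \<Longrightarrow> definable_pred M P"
  unfolding definable_pred_def by (intro exI allI)

lemma definable_predE:
  assumes "definable_pred M P"
  obtains p u where "\<And>v. P v = sat M (assign u v) p"
proof -
  from assms obtain p u where P: "\<forall>v. P v = sat M (assign u v) p"
    unfolding definable_pred_def by (elim exE) (rule that)
  show thesis by (rule that) (rule P[rule_format])
qed

lemma definable_pred_cong:
  assumes "definable_pred M P" "\<And>v. P v = Q v"
  shows "definable_pred M Q"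
proof -
  have "P = Q" using assms(2) by (rule ext)
  then show ?thesis using assms(1) by simp
qed

lemma definable_pred_not:
  assumes "definable_pred M P"
  shows "definable_pred M (\<lambda>v. \<not> P v)"
proof -
  obtain p u where "\<And>v. P v = sat M (assign u v) p" using assms by (rule definable_predE) (rule that)
  then show ?thesis by (intro definable_predI[of _ _ u "Neg p"]) (simp only: sat.simps)
qed

text \<open>The two formulas may use the same variable for different purposes. Moving one to the
  even and the other to the odd variables lets a single assignment serve both.\<close>

lemma definable_pred_conj:
  assumes "definable_pred M P" "definable_pred M Q"
  shows "definable_pred M (\<lambda>v. P v \<and> Q v)"
proof -
  obtain p u where P: "\<And>v. P v = sat M (assign u v) p"
    using assms(1) by (rule definable_predE) (rule that)
  obtain q w where Q: "\<And>v. Q v = sat M (assign w v) q"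
    using assms(2) by (rule definable_predE) (rule that)
  obtain p' where p': "\<forall>e. sat M e p' = sat M (\<lambda>i. e (2 * i)) p"
    using sat_rename[of M "\<lambda>i. 2 * i"] by blast
  obtain q' where q': "\<forall>e. sat M e q' = sat M (\<lambda>i. e (2 * i + 1)) q"
    using sat_rename[of M "\<lambda>i. 2 * i + 1"] by blast
  define t where "t i = (if even i then u (i div 2) else w (i div 2))" for i
  have "(\<lambda>i. assign t v (2 * i)) = assign u v" "(\<lambda>i. assign t v (2 * i + 1)) = assign w v" for v
    by (auto simp: assign_def t_def)
  then have "(P v \<and> Q v) = sat M (assign t v) (Conj p' q')" for v
    by (simp only: p' q' P Q sat.simps)
  then show ?thesis by (rule definable_predI)
qed

lemma definable_pred_disj:
  assumes "definable_pred M P" "definable_pred M Q"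
  shows "definable_pred M (\<lambda>v. P v \<or> Q v)"
proof -
  have "definable_pred M (\<lambda>v. \<not> (\<not> P v \<and> \<not> Q v))"
    by (intro definable_pred_not definable_pred_conj assms)
  then show ?thesis by simp
qed

lemma definable_pred_imp:
  assumes "definable_pred M P" "definable_pred M Q"
  shows "definable_pred M (\<lambda>v. P v \<longrightarrow> Q v)"
proof -
  have "definable_pred M (\<lambda>v. \<not> P v \<or> Q v)"
    by (intro definable_pred_not definable_pred_disj assms)
  then show ?thesis by simp
qed

lemma definable_pred_const: "definable_pred M (\<lambda>v. c)"
  by (rule definable_predI[of _ _ undefined "if c then Eq Zero Zero else Neg (Eq Zero Zero)"]) simp

lemma definable_pred_all_less:
  assumes "\<And>i. i < k \<Longrightarrow> definable_pred M (P i)"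
  shows "definable_pred M (\<lambda>v. \<forall>i<(k::nat). P i v)"
  using assms
proof (induction k)
  case (Suc k)
  have "definable_pred M (P k)" by (rule Suc.prems) simp
  moreover have "definable_pred M (\<lambda>v. \<forall>i<k. P i v)" by (rule Suc.IH, rule Suc.prems) simp
  ultimately show ?case unfolding All_less_Suc by (rule definable_pred_conj)
qed (simp add: definable_pred_const)

text \<open>Two assignments compose to one, so the formula itself need not change.\<close>

lemma definable_pred_subst:
  assumes "definable_pred M P"
  shows "definable_pred M (\<lambda>v. P (assign w v))"
proof -
  obtain p u where P: "\<And>v. P v = sat M (assign u v) p" using assms by (rule definable_predE) (rule that)
  have "assign u (assign w v) = assign (\<lambda>i. case_sum w Inr (u i)) v" for v
    by (auto simp: assign_def split: sum.splits)
  then show ?thesis by (intro definable_predI[of _ _ "\<lambda>i. case_sum w Inr (u i)" p]) (simp add: P)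
qed

lemma definable_pred_rename:
  assumes "definable_pred M P"
  shows "definable_pred M (\<lambda>v. P (\<lambda>i. v (\<tau> i)))"
  using definable_pred_subst[OF assms, of "\<lambda>i. Inl (\<tau> i)"] by (simp add: assign_def[abs_def])

lemma definable_pred_ex:
  assumes "definable_pred M (\<lambda>v. Q (\<lambda>i. v (Suc i)) (v 0))"
  shows "definable_pred M (\<lambda>v. \<exists>a. Q v a)"
proof -
  obtain p u where P: "\<And>v. Q (\<lambda>i. v (Suc i)) (v 0) = sat M (assign u v) p"
    using assms by (rule definable_predE) (rule that)
  \<comment> \<open>Several variables of \<open>p\<close> may refer to coordinate 0. All of them are
    merged into variable 0, which can then be quantified; the others move up by one.\<close>
  obtain q where q: "\<forall>e. sat M e q = sat M (\<lambda>i. e (if u i = Inl 0 then 0 else Suc i)) p"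
    using sat_rename[of M "\<lambda>i. if u i = Inl 0 then 0 else Suc i"] by blast
  \<comment> \<open>Coordinates drop by one because \<open>v\<close> loses its head. The entries of
    \<open>w\<close> at 0 and at places that referred to coordinate 0 are never read.\<close>
  define w where "w i = (case u (i - 1) of Inl j \<Rightarrow> Inl (j - 1) | Inr c \<Rightarrow> Inr c)" for i
  have "(\<exists>a. Q v a) = sat M (assign w v) (Exists 0 q)" for v
  proof -
    have "Q v a = sat M ((assign w v)(0 := a)) q" for a
    proof -
      have "Q v a = sat M (assign u (case_nat a v)) p"
        using P[of "case_nat a v"] by simp
      also have "assign u (case_nat a v) =
          (\<lambda>i. ((assign w v)(0 := a)) (if u i = Inl 0 then 0 else Suc i))"
        by (auto simp: assign_def w_def fun_eq_iff split: sum.splits nat.splits)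
      finally show ?thesis by (simp add: q)
    qed
    then show ?thesis by simp
  qed
  then show ?thesis by (rule definable_predI)
qed

lemma case_nat_tail: "case_nat (v 0) (\<lambda>i. v (Suc i)) = v"
  by (auto simp: fun_eq_iff split: nat.splits)

text \<open>Quantification over a point of M^n, by iterating the single quantifier. In the
  induction, coordinate \<open>n\<close> of the longer block is the head \<open>a\<close> of the
  remaining environment.\<close>

lemma definable_pred_ex_block:
  assumes "definable_pred M P"
  shows "definable_pred M (\<lambda>v. \<exists>x. P (\<lambda>i. if i < n then x i else v (i - n)))"
proof (induction n)
  case (Suc n)
  have "definable_pred M (\<lambda>v. \<exists>a. \<exists>x. P (\<lambda>i. if i < n then x i else case_nat a v (i - n)))"
  proof (rule definable_pred_ex)
    show "definable_pred M (\<lambda>v. \<exists>x. P (\<lambda>i. if i < n then x i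
        else case_nat (v 0) (\<lambda>i. v (Suc i)) (i - n)))"
      unfolding case_nat_tail using Suc .
  qed
  moreover have "(\<exists>a x. P (\<lambda>i. if i < n then x i else case_nat a v (i - n)))
      = (\<exists>x. P (\<lambda>i. if i < Suc n then x i else v (i - Suc n)))" (is "?L = ?R") for v
  proof
    assume ?L
    then obtain a x where "P (\<lambda>i. if i < n then x i else case_nat a v (i - n))" by blast
    also have "(\<lambda>i. if i < n then x i else case_nat a v (i - n))
        = (\<lambda>i. if i < Suc n then (x(n := a)) i else v (i - Suc n))"
      by (auto simp: fun_eq_iff less_Suc_eq split: nat.splits) (metis diff_Suc diff_Suc_1 nat.case(2))
    finally show ?R by blast
  next
    assume ?R
    then obtain x where "P (\<lambda>i. if i < Suc n then x i else v (i - Suc n))" by blast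
    also have "(\<lambda>i. if i < Suc n then x i else v (i - Suc n))
        = (\<lambda>i. if i < n then x i else case_nat (x n) v (i - n))"
      by (auto simp: fun_eq_iff less_Suc_eq split: nat.splits) (metis diff_Suc diff_Suc_1 nat.case(2))
    finally show ?L by blast
  qed
  ultimately show ?case by simp
qed (use assms in simp)

lemma definable_iff_definable_pred:
  "definable M n X \<longleftrightarrow> (\<exists>P. definable_pred M P \<and> X = {x \<in> cart n. P x})"
proof
  assume "definable M n X"
  then obtain p e where X: "X = {x \<in> cart n. sat M (\<lambda>i. if i < n then x i else e i) p}"
    unfolding definable_def by blast
  have "definable_pred M (\<lambda>x. sat M (\<lambda>i. if i < n then x i else e i) p)"
  proof (rule definable_predI)
    have "assign (\<lambda>i. if i < n then Inl i else Inr (e i)) x = (\<lambda>i. if i < n then x i else e i)"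
      for x :: "nat \<Rightarrow> 'a"
      by (auto simp: assign_def fun_eq_iff)
    then show "sat M (\<lambda>i. if i < n then x i else e i) p
        = sat M (assign (\<lambda>i. if i < n then Inl i else Inr (e i)) x) p" for x
      by simp
  qed
  then show "\<exists>P. definable_pred M P \<and> X = {x \<in> cart n. P x}" using X by blast
next
  assume "\<exists>P. definable_pred M P \<and> X = {x \<in> cart n. P x}"
  then obtain P where "definable_pred M P" and X: "X = {x \<in> cart n. P x}" by blast
  from this(1) obtain p u where P: "\<And>v. P v = sat M (assign u v) p" by (rule definable_predE) (rule that)
  \<comment> \<open>Variables that refer to genuine coordinates of the point go to those
    coordinates; every other variable is sent beyond \<open>n\<close>, where \<open>e\<close>
    supplies its value.\<close>
  define \<tau> where "\<tau> i = (case u i of Inl j \<Rightarrow> if j < n then j else n + i | Inr c \<Rightarrow> n + i)" for i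
  \<comment> \<open>A coordinate at or beyond \<open>n\<close> of an extensional point is
    \<open>undefined\<close>, so it becomes a parameter with this value.\<close>
  define e where "e i = (case u (i - n) of Inl j \<Rightarrow> undefined | Inr c \<Rightarrow> c)" for i
  obtain q where q: "\<forall>e. sat M e q = sat M (\<lambda>i. e (\<tau> i)) p" using sat_rename by blast
  have "assign u x = (\<lambda>i. if \<tau> i < n then x (\<tau> i) else e (\<tau> i))" if "x \<in> cart n" for x
    using that PiE_arb[OF that]
    by (auto simp: assign_def \<tau>_def e_def fun_eq_iff split: sum.splits)
  then have "X = {x \<in> cart n. sat M (\<lambda>i. if i < n then x i else e i) q}"
    unfolding X P q[rule_format] by (intro Collect_cong conj_cong refl) simp
  then show "definable M n X" unfolding definable_def by blast
qed

lemma definable_pred_mem: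
  assumes "definable M n X"
  shows "definable_pred M (\<lambda>v. restrict (\<lambda>i. v (\<tau> i)) {..<n} \<in> X)"
proof -
  obtain P where P: "definable_pred M P" "X = {x \<in> cart n. P x}"
    using assms definable_iff_definable_pred by blast
  \<comment> \<open>The restriction is itself an assignment: places from \<open>n\<close> on receive
    the parameter \<open>undefined\<close>.\<close>
  have "definable_pred M (\<lambda>v. P (assign (\<lambda>i. if i < n then Inl (\<tau> i) else Inr undefined) v))"
    using P(1) by (rule definable_pred_subst)
  moreover have "assign (\<lambda>i. if i < n then Inl (\<tau> i) else Inr undefined) v
      = restrict (\<lambda>i. v (\<tau> i)) {..<n}" for v :: "nat \<Rightarrow> 'a"
    by (auto simp: assign_def fun_eq_iff)
  ultimately show ?thesis by (simp only: P(2)) simp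
qed

text \<open>The de Bruijn convention for a block: the bound point takes the first \<open>n\<close>
  coordinates and the outer environment is shifted by \<open>n\<close>.\<close>

lemma definable_pred_bex:
  assumes "definable M n X"
    and "definable_pred M (\<lambda>v. Q (\<lambda>i. v (n + i)) (restrict v {..<n}))"
  shows "definable_pred M (\<lambda>v. \<exists>x\<in>X. Q v x)"
proof -
  have "definable_pred M (\<lambda>v. restrict v {..<n} \<in> X \<and> Q (\<lambda>i. v (n + i)) (restrict v {..<n}))"
    using definable_pred_mem[OF assms(1), of "\<lambda>i. i"] assms(2) by (rule definable_pred_conj)
  note definable_pred_ex_block[OF this, of n]
  moreover have "restrict (\<lambda>i. if i < n then x i else w i) {..<n} = restrict x {..<n}"
    for x w :: "nat \<Rightarrow> 'a"
    by auto
  ultimately have "definable_pred M (\<lambda>v. \<exists>x. restrict x {..<n} \<in> X \<and> Q v (restrict x {..<n}))"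
    by simp
  moreover have "(\<exists>x. restrict x {..<n} \<in> X \<and> Q v (restrict x {..<n})) = (\<exists>x\<in>X. Q v x)" for v
  proof -
    have "restrict x {..<n} = x" if "x \<in> X" for x
      using that assms(1) unfolding definable_def by (auto intro: PiE_restrict)
    then show ?thesis by metis
  qed
  ultimately show ?thesis by simp
qed

lemma definable_pred_ball:
  assumes "definable M n X"
    and "definable_pred M (\<lambda>v. Q (\<lambda>i. v (n + i)) (restrict v {..<n}))"
  shows "definable_pred M (\<lambda>v. \<forall>x\<in>X. Q v x)"
proof -
  have "definable_pred M (\<lambda>v. \<not> (\<exists>x\<in>X. \<not> Q v x))"
    by (intro definable_pred_not definable_pred_bex[OF assms(1)] assms(2))
  then show ?thesis by simp
qed

text \<open>Functions are total on environments, so that they compose like terms without conditions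
  on domains; partial maps are extended by 0 below.\<close>

definition definable_fun ::
  "('a::linordered_ab_group_add, 'f, 'r) expansion \<Rightarrow> ((nat \<Rightarrow> 'a) \<Rightarrow> 'a) \<Rightarrow> bool" where
  "definable_fun M t \<longleftrightarrow> definable_pred M (\<lambda>v. v 0 = t (\<lambda>i. v (Suc i)))"

lemma definable_fun_rename:
  assumes "definable_fun M t"
  shows "definable_fun M (\<lambda>v. t (\<lambda>i. v (\<tau> i)))"
  using definable_pred_rename[OF assms[unfolded definable_fun_def], of "case_nat 0 (\<lambda>i. Suc (\<tau> i))"]
  unfolding definable_fun_def by simp

text \<open>The value of \<open>t\<close> is eliminated by quantifying over some \<open>a\<close> on
  its graph.\<close>

lemma definable_pred_comp:
  assumes "definable_pred M P" "definable_fun M t"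
  shows "definable_pred M (\<lambda>v. P (case_nat (t v) v))"
proof -
  have "definable_pred M (\<lambda>v. \<exists>a. a = t v \<and> P (case_nat a v))"
  proof (rule definable_pred_ex, rule definable_pred_conj)
    show "definable_pred M (\<lambda>v. P (case_nat (v 0) (\<lambda>i. v (Suc i))))"
      unfolding case_nat_tail using assms(1) .
  qed (use assms in \<open>simp add: definable_fun_def\<close>)
  then show ?thesis by simp
qed

lemma definable_pred_comp2:
  assumes "definable_pred M (\<lambda>v. Q (v 1) (v 0))" "definable_fun M s" "definable_fun M t"
  shows "definable_pred M (\<lambda>v. Q (s v) (t v))"
proof -
  have "definable_pred M (\<lambda>v. Q (v 0) (t (\<lambda>i. v (Suc i))))"
    using definable_pred_comp[OF assms(1) definable_fun_rename[OF assms(3), of Suc]] by simp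
  from definable_pred_comp[OF this assms(2)] show ?thesis by simp
qed

section \<open>Closure of definability under terms, order and cases\<close>

lemma definable_fun_var: "definable_fun M (\<lambda>v. v j)"
  unfolding definable_fun_def
  by (rule definable_predI[of _ _ Inl "Eq (Var 0) (Var (Suc j))"]) (simp add: assign_def)

lemma definable_fun_const: "definable_fun M (\<lambda>v. c)"
  unfolding definable_fun_def
  by (rule definable_predI[of _ _ "case_nat (Inl 0) (\<lambda>_. Inr c)" "Eq (Var 0) (Var 1)"])
    (simp add: assign_def)

lemma definable_pred_eq:
  assumes "definable_fun M s" "definable_fun M t"
  shows "definable_pred M (\<lambda>v. s v = t v)"
  by (rule definable_pred_comp2[OF _ assms], rule definable_predI[of _ _ Inl "Eq (Var 1) (Var 0)"])
    (simp add: assign_def)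

lemma definable_pred_less:
  assumes "definable_fun M s" "definable_fun M t"
  shows "definable_pred M (\<lambda>v. s v < t v)"
  by (rule definable_pred_comp2[OF _ assms], rule definable_predI[of _ _ Inl "Less (Var 1) (Var 0)"])
    (simp add: assign_def)

lemma definable_pred_le:
  assumes "definable_fun M s" "definable_fun M t"
  shows "definable_pred M (\<lambda>v. s v \<le> t v)"
proof -
  have "definable_pred M (\<lambda>v. \<not> t v < s v)"
    by (intro definable_pred_not definable_pred_less assms)
  then show ?thesis by (simp add: not_less)
qed

lemma definable_fun_add:
  assumes "definable_fun M s" "definable_fun M t"
  shows "definable_fun M (\<lambda>v. s v + t v)"
proof -
  have *: "definable_pred M (\<lambda>v. v 2 = v 1 + v 0)"
    by (rule definable_predI[of _ _ Inl "Eq (Var 2) (Plus (Var 1) (Var 0))"]) (simp add: assign_def)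
  have "definable_pred M (\<lambda>v. v 1 = v 0 + t (\<lambda>i. v (Suc (Suc i))))"
    using definable_pred_comp[OF * definable_fun_rename[OF assms(2), of "\<lambda>i. Suc (Suc i)"]]
    by (simp add: numeral_2_eq_2)
  from definable_pred_comp[OF this definable_fun_rename[OF assms(1), of Suc]]
  show ?thesis by (simp add: definable_fun_def)
qed

lemma definable_fun_uminus:
  assumes "definable_fun M s"
  shows "definable_fun M (\<lambda>v. - s v)"
proof -
  have "definable_pred M (\<lambda>v. v 0 + s (\<lambda>i. v (Suc i)) = 0)"
    by (intro definable_pred_eq definable_fun_add definable_fun_rename[OF assms] definable_fun_var
        definable_fun_const)
  then show ?thesis by (simp add: definable_fun_def eq_neg_iff_add_eq_0)
qed

lemma definable_fun_diff:
  assumes "definable_fun M s" "definable_fun M t"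
  shows "definable_fun M (\<lambda>v. s v - t v)"
proof -
  have "definable_fun M (\<lambda>v. s v + - t v)"
    by (intro definable_fun_add definable_fun_uminus assms)
  then show ?thesis by simp
qed

lemma definable_fun_if:
  assumes "definable_pred M P" "definable_fun M s" "definable_fun M t"
  shows "definable_fun M (\<lambda>v. if P v then s v else t v)"
proof -
  have "definable_pred M (\<lambda>v. (P (\<lambda>i. v (Suc i)) \<longrightarrow> v 0 = s (\<lambda>i. v (Suc i)))
      \<and> (\<not> P (\<lambda>i. v (Suc i)) \<longrightarrow> v 0 = t (\<lambda>i. v (Suc i))))"
    by (intro definable_pred_conj definable_pred_imp definable_pred_not
        definable_pred_rename[OF assms(1)] assms(2,3)[unfolded definable_fun_def])
  then show ?thesis unfolding definable_fun_def by (rule definable_pred_cong) auto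
qed

lemma definable_fun_abs:
  fixes M :: "('a::linordered_idom, 'f, 'r) expansion"
  assumes "definable_fun M s"
  shows "definable_fun M (\<lambda>v. \<bar>s v\<bar>)"
  unfolding abs_if
  by (intro definable_fun_if definable_pred_less definable_fun_const definable_fun_uminus assms)

lemma definable_fun_max:
  assumes "definable_fun M s" "definable_fun M t"
  shows "definable_fun M (\<lambda>v. max (s v) (t v))"
  unfolding max_def by (intro definable_fun_if definable_pred_le assms)

section \<open>Definable sets, maps and bounded products as predicates\<close>

lemma definable1I:
  assumes "definable_pred M (\<lambda>v. v 0 \<in> X)"
  shows "definable1 M X"
  unfolding definable1_def definable_iff_definable_pred using assms by blast

lemma definable_map_graph:
  assumes "S \<subseteq> cart n"
  shows "(\<lambda>x. x(n := f x)) ` S = {y \<in> cart (Suc n). restrict y {..<n} \<in> S \<and> y n = f (restrict y {..<n})}"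
proof (intro equalityI subsetI)
  fix y assume "y \<in> (\<lambda>x. x(n := f x)) ` S"
  then obtain x where x: "x \<in> S" "y = x(n := f x)" by blast
  then have "x \<in> cart n" using assms by blast
  then have "restrict y {..<n} = x" using x(2) PiE_arb by (auto simp: fun_eq_iff restrict_def)
  moreover have "y \<in> cart (Suc n)"
    using x(2) PiE_arb[OF \<open>x \<in> cart n\<close>] by (auto simp: PiE_iff extensional_def)
  ultimately show "y \<in> {y \<in> cart (Suc n). restrict y {..<n} \<in> S \<and> y n = f (restrict y {..<n})}"
    using x by simp
next
  fix y assume y: "y \<in> {y \<in> cart (Suc n). restrict y {..<n} \<in> S \<and> y n = f (restrict y {..<n})}"
  then have "y = (restrict y {..<n})(n := f (restrict y {..<n}))"
    by (auto simp: fun_eq_iff PiE_iff extensional_def restrict_def)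
  then show "y \<in> (\<lambda>x. x(n := f x)) ` S" using y by blast
qed

lemma definable_pred_map:
  assumes "definable_map M n S f" "S \<subseteq> cart n"
  shows "definable_pred M (\<lambda>v. restrict (\<lambda>i. v (\<tau> i)) {..<n} \<in> S
    \<and> v k = f (restrict (\<lambda>i. v (\<tau> i)) {..<n}))"
proof -
  have "definable_pred M (\<lambda>v. restrict (\<lambda>i. v ((\<tau>(n := k)) i)) {..<Suc n}
      \<in> (\<lambda>x. x(n := f x)) ` S)"
    using assms(1) unfolding definable_map_def by (rule definable_pred_mem)
  moreover have "restrict (restrict (\<lambda>i. v ((\<tau>(n := k)) i)) {..<Suc n}) {..<n}
      = restrict (\<lambda>i. v (\<tau> i)) {..<n}" for v :: "nat \<Rightarrow> 'a"
    by (auto simp: fun_eq_iff)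
  ultimately show ?thesis
    unfolding definable_map_graph[OF assms(2)] by simp
qed

text \<open>The graph of \<open>f\<close> over \<open>S\<close> carries no information about
  \<open>f\<close> off \<open>S\<close>; extension by 0 gives a total definable function.\<close>

lemma definable_fun_map:
  assumes "definable_map M n S f" "definable M n S"
  shows "definable_fun M (\<lambda>v. if restrict v {..<n} \<in> S then f (restrict v {..<n}) else 0)"
proof -
  have S: "S \<subseteq> cart n" using assms(2) unfolding definable_def by blast
  have "definable_pred M (\<lambda>v. (restrict (\<lambda>i. v (Suc i)) {..<n} \<in> S
      \<and> v 0 = f (restrict (\<lambda>i. v (Suc i)) {..<n}))
    \<or> (\<not> restrict (\<lambda>i. v (Suc i)) {..<n} \<in> S \<and> v 0 = 0))"
    by (intro definable_pred_disj definable_pred_conj[OF definable_pred_not]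
        definable_pred_map[OF assms(1) S] definable_pred_mem[OF assms(2)]
        definable_pred_eq definable_fun_var definable_fun_const)
  then show ?thesis unfolding definable_fun_def by (rule definable_pred_cong) auto
qed

text \<open>Multiplication is available only on bounded squares, so the bounds on both factors are
  part of the predicate.\<close>

lemma definable_pred_mult:
  assumes "definable_bounded_mult M"
  shows "definable_pred M (\<lambda>v. v i \<in> {a<..<b} \<and> v j \<in> {a<..<b} \<and> v k = v i * v j)"
proof (cases "a < b")
  case True
  let ?D = "{..<2::nat} \<rightarrow>\<^sub>E {a<..<b}"
  define x where "x v = restrict (\<lambda>m. v (if m = 0 then i else j)) {..<2::nat}" for v :: "nat \<Rightarrow> 'a"
  have "definable_map M 2 ?D (\<lambda>x. x 0 * x 1)"
    using assms True unfolding definable_bounded_mult_def by blast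
  moreover have "?D \<subseteq> cart 2" by (intro PiE_mono subset_UNIV)
  ultimately have "definable_pred M (\<lambda>v. x v \<in> ?D \<and> v k = x v 0 * x v 1)"
    unfolding x_def by (rule definable_pred_map)
  moreover have "x v \<in> ?D \<longleftrightarrow> v i \<in> {a<..<b} \<and> v j \<in> {a<..<b}" for v
    unfolding PiE_iff x_def numeral_2_eq_2 lessThan_Suc by auto
  moreover have "x v 0 = v i" "x v 1 = v j" for v
    unfolding x_def by simp_all
  ultimately show ?thesis by (simp only: conj_assoc)
qed (simp add: definable_pred_const)

lemma definable_fun_coord:
  "k < n \<Longrightarrow> definable_fun M (\<lambda>v. restrict (\<lambda>i. v (\<tau> i)) {..<n} k)"
  using definable_fun_var[of M "\<tau> k"] by simp

lemmas definable_intros =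
  definable_pred_conj definable_pred_imp definable_pred_not definable_pred_ex definable_pred_eq
  definable_pred_less definable_pred_le definable_pred_all_less definable_fun_var
  definable_fun_const definable_fun_add definable_fun_diff definable_fun_uminus definable_fun_abs
  definable_fun_max definable_fun_coord

section \<open>Extrema of definable continuous functions\<close>

lemma open_contains_interval:
  fixes a :: "'a::{linordered_field, linorder_topology}"
  assumes "open U" "a \<in> U"
  shows "\<exists>\<epsilon>>0. \<forall>y. \<bar>y - a\<bar> \<le> \<epsilon> \<longrightarrow> y \<in> U"
proof -
  obtain b where b: "a < b" "{a..<b} \<subseteq> U" using open_right[OF assms, of "a + 1"] by auto
  obtain b' where b': "b' < a" "{b'<..a} \<subseteq> U" using open_left[OF assms, of "a - 1"] by auto
  obtain \<epsilon> where \<epsilon>: "0 < \<epsilon>" "\<epsilon> < min (b - a) (a - b')"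
    using dense[of 0 "min (b - a) (a - b')"] b b' by auto
  have "y \<in> U" if "\<bar>y - a\<bar> \<le> \<epsilon>" for y
  proof (cases "a \<le> y")
    case True
    then have "y \<in> {a..<b}" using that \<epsilon> by auto
    then show ?thesis using b by blast
  next
    case False
    then have "y \<in> {b'<..a}" using that \<epsilon> by auto
    then show ?thesis using b' by blast
  qed
  then show ?thesis using \<epsilon> by blast
qed

lemma openin_cart_contains_box:
  fixes W :: "(nat \<Rightarrow> 'a::{linordered_field, linorder_topology}) set"
  assumes "openin (cart_topology n) W" "c \<in> W"
  shows "\<exists>\<epsilon>>0. \<forall>x\<in>cart n. (\<forall>i<n. \<bar>x i - c i\<bar> \<le> \<epsilon>) \<longrightarrow> x \<in> W"
proof -
  obtain U where U: "\<forall>i\<in>{..<n}. open (U i)" "c \<in> PiE {..<n} U" "PiE {..<n} U \<subseteq> W"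
    using assms unfolding openin_product_topology_alt by (auto simp flip: open_openin)
  have "\<forall>i\<in>{..<n}. \<exists>\<epsilon>>0. \<forall>y. \<bar>y - c i\<bar> \<le> \<epsilon> \<longrightarrow> y \<in> U i"
    using U by (intro ballI open_contains_interval) auto
  then obtain E where E: "\<forall>i\<in>{..<n}. 0 < E i \<and> (\<forall>y. \<bar>y - c i\<bar> \<le> E i \<longrightarrow> y \<in> U i)"
    by (rule bchoice[THEN exE])
  \<comment> \<open>The extra 1 keeps the set nonempty when \<open>n = 0\<close>.\<close>
  define \<epsilon> where "\<epsilon> = Min (insert 1 (E ` {..<n}))"
  have "0 < \<epsilon>" unfolding \<epsilon>_def using E by (subst Min_gr_iff) auto
  moreover have le: "\<epsilon> \<le> E i" if "i < n" for i unfolding \<epsilon>_def using that by (intro Min_le) auto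
  have "x \<in> W" if x: "x \<in> cart n" "\<forall>i<n. \<bar>x i - c i\<bar> \<le> \<epsilon>" for x
  proof -
    have "x i \<in> U i" if "i < n" for i
      using E that order_trans[OF _ le[OF that]] x(2) by blast
    then have "x \<in> PiE {..<n} U" using x(1) by (auto simp: PiE_iff)
    then show ?thesis using U(3) by blast
  qed
  ultimately show ?thesis by blast
qed

lemma closedin_cart_limit:
  fixes S :: "(nat \<Rightarrow> 'a::{linordered_field, linorder_topology}) set"
  assumes "closedin (cart_topology n) S" "c \<in> cart n"
    and "\<And>\<epsilon>. 0 < \<epsilon> \<Longrightarrow> \<exists>x\<in>S. \<forall>i<n. \<bar>x i - c i\<bar> \<le> \<epsilon>"
  shows "c \<in> S"
proof (rule ccontr)
  assume "c \<notin> S"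
  have *: "openin (cart_topology n) (cart n - S)" "S \<subseteq> cart n"
    using assms(1) by (auto simp: closedin_def)
  obtain \<epsilon> where "0 < \<epsilon>" "\<forall>x\<in>cart n. (\<forall>i<n. \<bar>x i - c i\<bar> \<le> \<epsilon>) \<longrightarrow> x \<in> cart n - S"
    using openin_cart_contains_box[OF *(1), of c] assms(2) \<open>c \<notin> S\<close> by blast
  then show False using assms(3)[of \<epsilon>] *(2) by blast
qed

text \<open>The order topology need not come from a real-valued metric, so closeness is measured
  coordinatewise in M itself, which is also how the approximate maxima below are found.\<close>

definition box_continuous ::
  "nat \<Rightarrow> (nat \<Rightarrow> 'a::linordered_field) set \<Rightarrow> ((nat \<Rightarrow> 'a) \<Rightarrow> 'a) \<Rightarrow> bool" where
  "box_continuous n S h \<longleftrightarrow> (\<forall>c\<in>S. \<forall>\<epsilon>>0. \<exists>\<delta>>0. \<forall>x\<in>S.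
    (\<forall>i<n. \<bar>x i - c i\<bar> \<le> \<delta>) \<longrightarrow> \<bar>h x - h c\<bar> < \<epsilon>)"

lemma box_continuousE:
  assumes "box_continuous n S h" "c \<in> S" "0 < \<epsilon>"
  obtains \<delta> where "0 < \<delta>" "\<And>x. x \<in> S \<Longrightarrow> (\<forall>i<n. \<bar>x i - c i\<bar> \<le> \<delta>) \<Longrightarrow> \<bar>h x - h c\<bar> < \<epsilon>"
proof -
  from assms obtain \<delta> where "0 < \<delta>" "\<forall>x\<in>S. (\<forall>i<n. \<bar>x i - c i\<bar> \<le> \<delta>) \<longrightarrow> \<bar>h x - h c\<bar> < \<epsilon>"
    unfolding box_continuous_def by blast
  then show thesis by (intro that[of \<delta>]) blast+
qed

lemma box_continuous_continuous_map:
  fixes h :: "(nat \<Rightarrow> 'a) \<Rightarrow> 'a::{linordered_field, linorder_topology}"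
  assumes "continuous_map (subtopology (cart_topology n) S) euclidean h" "S \<subseteq> cart n"
  shows "box_continuous n S h"
  unfolding box_continuous_def
proof (intro ballI allI impI)
  fix c and \<epsilon> :: 'a
  assume c: "c \<in> S" and "0 < \<epsilon>"
  have top: "topspace (subtopology (cart_topology n) S :: (nat \<Rightarrow> 'a) topology) = S"
    using assms(2) by (simp add: Int_absorb1)
  have "openin (subtopology (cart_topology n) S) {x \<in> S. h x \<in> {h c - \<epsilon><..<h c + \<epsilon>}}"
    by (rule openin_continuous_map_preimage[OF assms(1), unfolded top])
      (simp flip: open_openin)
  then obtain T where T: "openin (cart_topology n) T"
    "{x \<in> S. h x \<in> {h c - \<epsilon><..<h c + \<epsilon>}} = T \<inter> S"
    unfolding openin_subtopology by (elim exE conjE) (rule that)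
  have "c \<in> T \<inter> S" unfolding T(2)[symmetric] using c \<open>0 < \<epsilon>\<close> by simp
  then have "c \<in> T" by simp
  then obtain \<delta> where \<delta>: "0 < \<delta>" "\<forall>x\<in>cart n. (\<forall>i<n. \<bar>x i - c i\<bar> \<le> \<delta>) \<longrightarrow> x \<in> T"
    using openin_cart_contains_box[OF T(1) \<open>c \<in> T\<close>] by (elim exE conjE) (rule that)
  have "\<bar>h x - h c\<bar> < \<epsilon>" if x: "x \<in> S" "\<forall>i<n. \<bar>x i - c i\<bar> \<le> \<delta>" for x
  proof -
    have "x \<in> T" using \<delta>(2) subsetD[OF assms(2) x(1)] x(2) by blast
    then have "x \<in> {x \<in> S. h x \<in> {h c - \<epsilon><..<h c + \<epsilon>}}" unfolding T(2) using x(1) by simp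
    then show ?thesis by (auto simp: abs_less_iff)
  qed
  then show "\<exists>\<delta>>0. \<forall>x\<in>S. (\<forall>i<n. \<bar>x i - c i\<bar> \<le> \<delta>) \<longrightarrow> \<bar>h x - h c\<bar> < \<epsilon>"
    using \<delta>(1) by blast
qed

lemma box_continuous_cong:
  "(\<And>x. x \<in> S \<Longrightarrow> h x = h' x) \<Longrightarrow> box_continuous n S h \<longleftrightarrow> box_continuous n S h'"
  unfolding box_continuous_def by simp

text \<open>Covers negation, absolute value and the truncation
  \<open>max (t - \<bar>a\<bar>) 0\<close>.\<close>

lemma box_continuous_nonexpansive:
  assumes "box_continuous n S h" "\<And>a b. \<bar>\<phi> a - \<phi> b\<bar> \<le> \<bar>a - b\<bar>"
  shows "box_continuous n S (\<lambda>x. \<phi> (h x))"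
  unfolding box_continuous_def
proof (intro ballI allI impI)
  fix c and \<epsilon> :: 'a
  assume "c \<in> S" "0 < \<epsilon>"
  then obtain \<delta> where \<delta>: "0 < \<delta>"
    "\<And>x. x \<in> S \<Longrightarrow> \<forall>i<n. \<bar>x i - c i\<bar> \<le> \<delta> \<Longrightarrow> \<bar>h x - h c\<bar> < \<epsilon>"
    using box_continuousE[OF assms(1)] by blast
  have "\<bar>\<phi> (h x) - \<phi> (h c)\<bar> < \<epsilon>" if "x \<in> S" "\<forall>i<n. \<bar>x i - c i\<bar> \<le> \<delta>" for x
    using assms(2) \<delta>(2)[OF that] by (rule le_less_trans)
  then show "\<exists>\<delta>>0. \<forall>x\<in>S. (\<forall>i<n. \<bar>x i - c i\<bar> \<le> \<delta>) \<longrightarrow> \<bar>\<phi> (h x) - \<phi> (h c)\<bar> < \<epsilon>"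
    using \<delta>(1) by blast
qed

lemma box_continuous_add:
  assumes "box_continuous n S h" "box_continuous n S h'"
  shows "box_continuous n S (\<lambda>x. h x + h' x)"
  unfolding box_continuous_def
proof (intro ballI allI impI)
  fix c and \<epsilon> :: 'a
  assume c: "c \<in> S" and "0 < \<epsilon>"
  then have "0 < \<epsilon> / 2" by simp
  obtain \<delta> where \<delta>: "0 < \<delta>" "\<And>x. x \<in> S \<Longrightarrow> \<forall>i<n. \<bar>x i - c i\<bar> \<le> \<delta> \<Longrightarrow> \<bar>h x - h c\<bar> < \<epsilon> / 2"
    using box_continuousE[OF assms(1) c \<open>0 < \<epsilon> / 2\<close>] by blast
  obtain \<delta>' where \<delta>': "0 < \<delta>'"
    "\<And>x. x \<in> S \<Longrightarrow> \<forall>i<n. \<bar>x i - c i\<bar> \<le> \<delta>' \<Longrightarrow> \<bar>h' x - h' c\<bar> < \<epsilon> / 2"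
    using box_continuousE[OF assms(2) c \<open>0 < \<epsilon> / 2\<close>] by blast
  have "\<bar>h x + h' x - (h c + h' c)\<bar> < \<epsilon>"
    if "x \<in> S" "\<forall>i<n. \<bar>x i - c i\<bar> \<le> min \<delta> \<delta>'" for x
  proof -
    have "\<bar>h x - h c\<bar> < \<epsilon> / 2" "\<bar>h' x - h' c\<bar> < \<epsilon> / 2" using that \<delta>(2) \<delta>'(2) by auto
    then have "\<bar>h x - h c\<bar> + \<bar>h' x - h' c\<bar> < \<epsilon> / 2 + \<epsilon> / 2" by (rule add_strict_mono)
    moreover have "\<bar>h x + h' x - (h c + h' c)\<bar> \<le> \<bar>h x - h c\<bar> + \<bar>h' x - h' c\<bar>"
      using abs_triangle_ineq[of "h x - h c" "h' x - h' c"] by (simp add: algebra_simps)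
    ultimately show ?thesis by simp
  qed
  moreover have "0 < min \<delta> \<delta>'" using \<delta>(1) \<delta>'(1) by simp
  ultimately show "\<exists>\<delta>>0. \<forall>x\<in>S. (\<forall>i<n. \<bar>x i - c i\<bar> \<le> \<delta>) \<longrightarrow> \<bar>h x + h' x - (h c + h' c)\<bar> < \<epsilon>"
    by blast
qed

section \<open>Suprema and the existence of extrema\<close>

lemma definably_complete_sup:
  assumes "definably_complete M" "definable1 M X" "y \<in> X" "\<And>x. x \<in> X \<Longrightarrow> x \<le> b"
  shows "\<exists>s. (\<forall>x\<in>X. x \<le> s) \<and> (\<forall>u<s. \<exists>x\<in>X. u < x)"
proof -
  obtain s where "isLub UNIV (Fin ` X) s"
    using assms(1,2) unfolding definably_complete_def by blast
  then have ub: "\<And>x. x \<in> X \<Longrightarrow> Fin x \<le> s" and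
    least: "\<And>u. (\<And>x. x \<in> X \<Longrightarrow> Fin x \<le> u) \<Longrightarrow> s \<le> u"
    by (auto simp: isLub_def leastP_def isUb_def setle_def setge_def)
  have "s \<le> Fin b" using assms(4) by (intro least) simp
  moreover have "Fin y \<le> s" using assms(3) by (rule ub)
  \<comment> \<open>Being between \<open>Fin y\<close> and \<open>Fin b\<close>, the supremum cannot
    be infinite.\<close>
  ultimately obtain s' where s': "s = Fin s'" by (cases s) auto
  show ?thesis
  proof (intro exI conjI ballI allI impI)
    show "x \<le> s'" if "x \<in> X" for x using ub[OF that] s' by simp
    show "\<exists>x\<in>X. u < x" if "u < s'" for u
    proof (rule ccontr)
      assume "\<not> (\<exists>x\<in>X. u < x)"
      then have "s \<le> Fin u" by (intro least) (auto simp: not_less)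
      then show False using that s' by simp
    qed
  qed
qed

text \<open>The coordinates of a maximum are found one after the other: the next coordinate is the supremum
  of the lower bounds for that coordinate on the sets of points where \<open>h\<close> is large and
  the earlier coordinates are almost right.\<close>

lemma definable_attains_sup:
  fixes M :: "('a::{linordered_field, linorder_topology}, 'f, 'r) expansion"
  assumes "definably_complete M" "definable M n S" "closedin (cart_topology n) S"
    and "bounded_cart n S" "S \<noteq> {}"
    and h: "definable_fun M (\<lambda>v. h (restrict v {..<n}))" "box_continuous n S h"
  shows "\<exists>c\<in>S. \<forall>x\<in>S. h x \<le> h c"
proof -
  obtain a b where ab: "\<And>x i. x \<in> S \<Longrightarrow> i < n \<Longrightarrow> a \<le> x i \<and> x i \<le> b"
    using assms(4) unfolding bounded_cart_def by blast
  obtain z0 where z0: "z0 \<in> S" using assms(5) by blast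
  \<comment> \<open>Here \<open>c\<close> is fixed before \<open>z\<close> and the tolerance: in its
    first \<open>k\<close> coordinates it is a cluster point of every superlevel set of
    \<open>h\<close> at once.\<close>
  have "\<exists>c. \<forall>z\<in>S. \<forall>\<epsilon>>0. \<exists>x\<in>S. h z \<le> h x \<and> (\<forall>i<k. \<bar>x i - c i\<bar> \<le> \<epsilon>)" if "k \<le> n" for k
    using that
  proof (induction k)
    case 0
    have "\<exists>x\<in>S. h z \<le> h x \<and> (\<forall>i<0. \<bar>x i - c i\<bar> \<le> \<epsilon>)" if "z \<in> S" for z c \<epsilon>
      using that by (intro bexI[of _ z]) simp_all
    then show ?case by blast
  next
    case (Suc k)
    then obtain c where c: "\<forall>z\<in>S. \<forall>\<epsilon>>0. \<exists>x\<in>S. h z \<le> h x \<and> (\<forall>i<k. \<bar>x i - c i\<bar> \<le> \<epsilon>)"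
      using Suc_leD by blast
    have k: "k < n" using Suc.prems by simp
    \<comment> \<open>The supremum of \<open>X\<close> is the lower limit of coordinate
      \<open>k\<close> along these sets, which are directed because the values of \<open>h\<close>
      are linearly ordered.\<close>
    define X where "X = {y. \<exists>z\<in>S. \<exists>\<epsilon>. 0 < \<epsilon> \<and>
        (\<forall>x\<in>S. h z \<le> h x \<and> (\<forall>i<k. \<bar>x i - c i\<bar> \<le> \<epsilon>) \<longrightarrow> y \<le> x k)}"
    have "definable1 M X"
      unfolding X_def
      by (rule definable1I, unfold mem_Collect_eq)
        (use k in \<open>intro definable_pred_bex[OF assms(2)] definable_pred_ball[OF assms(2)]
          definable_intros definable_fun_rename[OF h(1)]; simp\<close>)
    moreover have "a \<in> X"
      unfolding X_def mem_Collect_eq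
    proof (intro bexI exI conjI ballI impI)
      show "a \<le> x k" if "x \<in> S" for x using ab[OF that k] by simp
    qed (rule zero_less_one, rule z0)
    moreover have "y \<le> b" if y: "y \<in> X" for y
    proof -
      obtain z \<epsilon> where z: "z \<in> S" "0 < \<epsilon>"
        "\<forall>x\<in>S. h z \<le> h x \<and> (\<forall>i<k. \<bar>x i - c i\<bar> \<le> \<epsilon>) \<longrightarrow> y \<le> x k"
        using y unfolding X_def by blast
      obtain x where "x \<in> S" "y \<le> x k" using c z by blast
      then show ?thesis using ab[OF \<open>x \<in> S\<close> k] by simp
    qed
    ultimately have "\<exists>s. (\<forall>x\<in>X. x \<le> s) \<and> (\<forall>u<s. \<exists>x\<in>X. u < x)"
      by (rule definably_complete_sup[OF assms(1)])
    then obtain s where s: "\<forall>x\<in>X. x \<le> s" "\<forall>u<s. \<exists>x\<in>X. u < x" by blast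
    have "\<exists>x\<in>S. h z \<le> h x \<and> (\<forall>i<Suc k. \<bar>x i - (c(k := s)) i\<bar> \<le> \<epsilon>)"
      if "z \<in> S" "0 < \<epsilon>" for z \<epsilon>
    proof -
      have "s - \<epsilon> < s" using \<open>0 < \<epsilon>\<close> by simp
      then obtain y where "y \<in> X" and y: "s - \<epsilon> < y" using s(2) by blast
      then obtain z' \<epsilon>' where z': "z' \<in> S" "0 < \<epsilon>'"
        "\<forall>x\<in>S. h z' \<le> h x \<and> (\<forall>i<k. \<bar>x i - c i\<bar> \<le> \<epsilon>') \<longrightarrow> y \<le> x k"
        unfolding X_def by blast
      \<comment> \<open>Passing to the larger value of \<open>h\<close> makes one point
        \<open>x\<close> satisfy the constraints of both \<open>z\<close> and
        \<open>z'\<close>.\<close>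
      define z'' where "z'' = (if h z \<le> h z' then z' else z)"
      have z'': "z'' \<in> S" "h z \<le> h z''" "h z' \<le> h z''" using \<open>z \<in> S\<close> z' by (auto simp: z''_def)
      \<comment> \<open>As \<open>s + \<epsilon>\<close> is no lower bound, some admissible
        \<open>x\<close> has its coordinate below it; the lower bound \<open>y\<close> keeps the
        same coordinate above \<open>s - \<epsilon>\<close>.\<close>
      have "s + \<epsilon> \<notin> X" using s(1) \<open>0 < \<epsilon>\<close> by fastforce
      moreover have "0 < min \<epsilon> \<epsilon>'" using \<open>0 < \<epsilon>\<close> z'(2) by simp
      ultimately have "\<not> (\<forall>x\<in>S. h z'' \<le> h x \<and> (\<forall>i<k. \<bar>x i - c i\<bar> \<le> min \<epsilon> \<epsilon>')
          \<longrightarrow> s + \<epsilon> \<le> x k)"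
        using z''(1) unfolding X_def by blast
      then obtain x where x: "x \<in> S" "h z'' \<le> h x" "\<forall>i<k. \<bar>x i - c i\<bar> \<le> min \<epsilon> \<epsilon>'" "x k < s + \<epsilon>"
        using not_le by blast
      have "h z' \<le> h x" using z''(3) x(2) by (rule order_trans)
      moreover have "\<forall>i<k. \<bar>x i - c i\<bar> \<le> \<epsilon>'" using x(3) by simp
      ultimately have "y \<le> x k" using z'(3) x(1) by blast
      then have "\<bar>x k - s\<bar> \<le> \<epsilon>" using y x(4) by (auto simp: abs_le_iff)
      then have "\<forall>i<Suc k. \<bar>x i - (c(k := s)) i\<bar> \<le> \<epsilon>" using x(3) by (auto simp: less_Suc_eq)
      moreover have "h z \<le> h x" using z''(2) x(2) by simp
      ultimately show ?thesis using x(1) by blast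
    qed
    then show ?case by blast
  qed
  from this[OF order_refl] obtain c0 where
    c0: "\<forall>z\<in>S. \<forall>\<epsilon>>0. \<exists>x\<in>S. h z \<le> h x \<and> (\<forall>i<n. \<bar>x i - c0 i\<bar> \<le> \<epsilon>)"
    by (elim exE) (rule that)
  define c where "c = restrict c0 {..<n}"
  have c: "\<exists>x\<in>S. h z \<le> h x \<and> (\<forall>i<n. \<bar>x i - c i\<bar> \<le> \<epsilon>)" if "z \<in> S" "0 < \<epsilon>" for z \<epsilon>
    using c0 that by (simp add: c_def)
  have "c \<in> cart n" unfolding c_def by simp
  then have "c \<in> S" using c[OF z0] by (intro closedin_cart_limit[OF assms(3)]) blast+
  moreover have "h z \<le> h c" if z: "z \<in> S" for z
  proof (rule ccontr)
    assume "\<not> h z \<le> h c"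
    \<comment> \<open>With this gap as tolerance, a point near \<open>c\<close> where
      \<open>h\<close> is at least \<open>h z\<close> contradicts continuity at
      \<open>c\<close>.\<close>
    then have "0 < h z - h c" by simp
    then obtain \<delta> where "0 < \<delta>"
      "\<And>x. x \<in> S \<Longrightarrow> (\<forall>i<n. \<bar>x i - c i\<bar> \<le> \<delta>) \<Longrightarrow> \<bar>h x - h c\<bar> < h z - h c"
      using box_continuousE[OF h(2) \<open>c \<in> S\<close>] by blast
    moreover from this(1) obtain x where "x \<in> S" "h z \<le> h x" "\<forall>i<n. \<bar>x i - c i\<bar> \<le> \<delta>"
      using c[OF z] by blast
    ultimately have "\<bar>h x - h c\<bar> < h z - h c" "h z \<le> h x" by blast+
    then show False by (simp add: abs_less_iff)
  qed
  ultimately show ?thesis by blast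
qed

lemma definable_attains_inf:
  fixes M :: "('a::{linordered_field, linorder_topology}, 'f, 'r) expansion"
  assumes "definably_complete M" "definable M n S" "closedin (cart_topology n) S"
    and "bounded_cart n S" "S \<noteq> {}"
    and "definable_fun M (\<lambda>v. h (restrict v {..<n}))" "box_continuous n S h"
  shows "\<exists>c\<in>S. \<forall>x\<in>S. h c \<le> h x"
proof -
  have "definable_fun M (\<lambda>v. - h (restrict v {..<n}))"
    using assms(6) by (rule definable_fun_uminus)
  moreover have "box_continuous n S (\<lambda>x. - h x)"
    using assms(7) by (rule box_continuous_nonexpansive) (simp add: abs_minus_commute)
  ultimately show ?thesis
    using definable_attains_sup[OF assms(1-5), of "\<lambda>x. - h x"] by simp
qed

lemma lipschitz_continuous_on:
  fixes f :: "'a::{linordered_field, linorder_topology} \<Rightarrow> 'a"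
  assumes lip: "\<And>s t. s \<in> A \<Longrightarrow> t \<in> A \<Longrightarrow> \<bar>f s - f t\<bar> \<le> C * \<bar>s - t\<bar>"
  shows "continuous_on A f"
  unfolding continuous_on_def
proof (intro ballI)
  fix t assume t: "t \<in> A"
  have near: "\<forall>\<^sub>F s in at t within A. \<bar>f s - f t\<bar> < \<epsilon>" if "0 < \<epsilon>" for \<epsilon>
  proof -
    \<comment> \<open>The added 1 makes the denominator positive even for
      \<open>C = 0\<close>.\<close>
    define \<delta> where "\<delta> = \<epsilon> / (\<bar>C\<bar> + 1)"
    have "0 < \<delta>" using that unfolding \<delta>_def by (simp add: add_nonneg_pos)
    then have "\<forall>\<^sub>F s in at t within A. s \<in> {t - \<delta><..<t + \<delta>} \<and> s \<in> A"
      by (intro eventually_conj) (auto simp: eventually_at_topological intro!: exI[of _ "{t - \<delta><..<t + \<delta>}"])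
    then show ?thesis
    proof eventually_elim
      case (elim s)
      then have "\<bar>s - t\<bar> < \<delta>" by (auto simp: abs_less_iff)
      have "\<bar>f s - f t\<bar> \<le> C * \<bar>s - t\<bar>" using elim t lip by blast
      also have "\<dots> \<le> (\<bar>C\<bar> + 1) * \<bar>s - t\<bar>" by (intro mult_right_mono) auto
      also have "\<dots> < (\<bar>C\<bar> + 1) * \<delta>" using \<open>\<bar>s - t\<bar> < \<delta>\<close> by (intro mult_strict_left_mono) auto
      also have "\<dots> = \<epsilon>" unfolding \<delta>_def using abs_ge_zero[of C] by (simp add: add_nonneg_pos less_imp_neq[symmetric])
      finally show ?case .
    qed
  qed
  show "(f \<longlongrightarrow> f t) (at t within A)"
  proof (rule order_tendstoI)
    fix u assume "u < f t"
    then show "\<forall>\<^sub>F s in at t within A. u < f s"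
      using near[of "f t - u"] by (auto elim!: eventually_mono simp: abs_less_iff)
  next
    fix u assume "f t < u"
    then show "\<forall>\<^sub>F s in at t within A. f s < u"
      using near[of "u - f t"] by (auto elim!: eventually_mono simp: abs_less_iff)
  qed
qed

section \<open>The inequality\<close>

lemma lojasiewicz_gauge:
  fixes M :: "('a::{linordered_field, linorder_topology}, 'f, 'r) expansion"
  assumes M: "definably_complete M" "definable_bounded_mult M"
    and S: "definable M n S" "closedin (cart_topology n) S" "bounded_cart n S" "S \<noteq> {}"
    and f: "definable_fun M (\<lambda>v. f (restrict v {..<n}))" "box_continuous n S f"
    and g: "definable_fun M (\<lambda>v. g (restrict v {..<n}))" "box_continuous n S g"
    and zeros: "\<And>x. x \<in> S \<Longrightarrow> f x = 0 \<Longrightarrow> g x = 0"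
  obtains l where "definable_increasing M 1 l"
    and "\<And>x. x \<in> S \<Longrightarrow> \<bar>g x\<bar> \<le> 1 \<Longrightarrow> l \<bar>g x\<bar> \<le> \<bar>f x\<bar>"
    and "\<And>\<delta>. 0 < \<delta> \<Longrightarrow> \<exists>c>0. \<forall>x\<in>S. \<delta> \<le> \<bar>g x\<bar> \<longrightarrow> c \<le> \<bar>f x\<bar>"
proof -
  \<comment> \<open>The second summand is a penalty replacing the constraint
    \<open>t \<le> \<bar>g x\<bar>\<close>. The minimum thus exists even if no point meets the
    constraint, and it inherits the Lipschitz dependence of the penalty on \<open>t\<close>.\<close>
  define F where "F t x = \<bar>f x\<bar> + max (t - \<bar>g x\<bar>) 0" for t x
  have "\<exists>c\<in>S. \<forall>x\<in>S. F t c \<le> F t x" for t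
  proof (rule definable_attains_inf[OF M(1) S])
    show "definable_fun M (\<lambda>v. F t (restrict v {..<n}))"
      unfolding F_def by (intro definable_intros f(1) g(1))
    have "\<bar>max (t - \<bar>a\<bar>) 0 - max (t - \<bar>b\<bar>) 0\<bar> \<le> \<bar>a - b\<bar>" for a b :: 'a
      by (auto simp: max_def abs_if)
    then show "box_continuous n S (F t)"
      unfolding F_def
      by (intro box_continuous_add box_continuous_nonexpansive[OF f(2)]
          box_continuous_nonexpansive[OF g(2)] abs_triangle_ineq3)
  qed
  then obtain c where c: "\<And>t. c t \<in> S" "\<And>t x. x \<in> S \<Longrightarrow> F t (c t) \<le> F t x"
    by metis
  define k where "k t = F t (c t)" for t
  \<comment> \<open>The minimisers \<open>c t\<close> are an arbitrary choice, but the minimal value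
    is described without them; this makes \<open>k\<close> definable.\<close>
  have k_eq: "a = k t \<longleftrightarrow> (\<exists>x\<in>S. a = F t x) \<and> (\<forall>x\<in>S. a \<le> F t x)" for a t
  proof
    assume "(\<exists>x\<in>S. a = F t x) \<and> (\<forall>x\<in>S. a \<le> F t x)"
    then obtain x where "x \<in> S" "a = F t x" "\<forall>x\<in>S. a \<le> F t x" by blast
    then show "a = k t" using c(1)[of t] c(2)[of x t] unfolding k_def by (intro antisym) auto
  qed (use c in \<open>auto simp: k_def\<close>)
  have k_le: "k t \<le> \<bar>f x\<bar>" if "x \<in> S" "t \<le> \<bar>g x\<bar>" for t x
    using c(2)[OF that(1), of t] that(2) by (simp add: k_def F_def)
  \<comment> \<open>At a minimiser either \<open>f\<close> is nonzero, or \<open>g\<close> vanishes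
    too and the penalty is the full \<open>t\<close>.\<close>
  have k_pos: "0 < k t" if "0 < t" for t
  proof (cases "f (c t) = 0")
    case True
    then have "g (c t) = 0" using zeros c(1) by blast
    then show ?thesis using True that by (simp add: k_def F_def)
  qed (simp add: k_def F_def add_pos_nonneg)
  have k_mono: "k s \<le> k t" if "s \<le> t" for s t
  proof -
    have "k s \<le> F s (c t)" unfolding k_def by (rule c(2)[OF c(1)])
    also have "\<dots> \<le> k t" unfolding k_def F_def using that by (intro add_left_mono max.mono) auto
    finally show ?thesis .
  qed
  have k_lip: "k t \<le> k s + (t - s)" if "s \<le> t" for s t
  proof -
    have "k t \<le> F t (c s)" unfolding k_def by (rule c(2)[OF c(1)])
    also have "\<dots> \<le> k s + (t - s)" unfolding k_def F_def using that by (auto simp: max_def)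
    finally show ?thesis .
  qed
  have k_nonneg: "0 \<le> k t" for t by (simp add: k_def F_def)
  \<comment> \<open>The factor \<open>t\<close> makes a merely nondecreasing \<open>k\<close>
    strictly increasing, and gives the value 0 at 0 even when \<open>f\<close> has no zero on
    \<open>S\<close> and \<open>k 0\<close> is positive.\<close>
  define l where "l t = t * k t" for t
  have l_diff: "l t - l s = (t - s) * k t + s * (k t - k s)" for s t
    by (simp add: l_def algebra_simps)
  have l_less: "l s < l t" if "0 \<le> s" "s < t" for s t
  proof -
    have "0 < (t - s) * k t" using that k_pos by simp
    moreover have "0 \<le> s * (k t - k s)" using that k_mono by simp
    ultimately have "0 < l t - l s" unfolding l_diff by (rule add_pos_nonneg)
    then show ?thesis by simp
  qed
  \<comment> \<open>The constant comes from \<open>k t \<le> k 1\<close>, \<open>s \<le> 1\<close>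
    and \<open>k t - k s \<le> t - s\<close>.\<close>
  have l_lip: "\<bar>l t - l s\<bar> \<le> (k 1 + 1) * \<bar>t - s\<bar>" if "0 \<le> s" "s \<le> t" "t \<le> 1" for s t
  proof -
    have "l s \<le> l t" using l_less[of s t] that by (cases "s = t") auto
    then have "\<bar>l t - l s\<bar> = (t - s) * k t + s * (k t - k s)"
      unfolding l_diff[symmetric] by simp
    also have "\<dots> \<le> (t - s) * k 1 + 1 * (t - s)"
      using that k_mono[of t 1] k_mono[of s t] k_lip[of s t]
      by (intro add_mono mult_left_mono mult_mono) auto
    also have "\<dots> = (k 1 + 1) * \<bar>t - s\<bar>" using that by (simp add: algebra_simps)
    finally show ?thesis .
  qed
  have "definable_increasing M 1 l"
    unfolding definable_increasing_def
  proof (intro conjI)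
    have k_def': "definable_fun M (\<lambda>v. k (v (0::nat)))"
      unfolding definable_fun_def k_eq F_def
      by (intro definable_intros definable_pred_bex[OF S(1)] definable_pred_ball[OF S(1)] f(1) g(1))
    \<comment> \<open>An open interval containing both factors \<open>t\<close> and
      \<open>k t\<close> for all \<open>t\<close> in [0, 1], so that bounded multiplication defines
      their product.\<close>
    let ?I = "{- 1<..<k 1 + 2}"
    define P where "P v \<longleftrightarrow> 0 \<le> v 0 \<and> v 0 \<le> 1 \<and> (\<exists>w. w = k (v 0) \<and>
        (v 0 \<in> ?I \<and> w \<in> ?I \<and> v 1 = v 0 * w))" for v :: "nat \<Rightarrow> 'a"
    have "definable_pred M P"
      unfolding P_def
      by (intro definable_intros definable_fun_rename[OF k_def', of Suc] definable_pred_mult[OF M(2)])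
    moreover have "P v \<longleftrightarrow> 0 \<le> v 0 \<and> v 0 \<le> 1 \<and> v 1 = l (v 0)" for v
    proof -
      have "v 0 \<in> ?I \<and> k (v 0) \<in> ?I" if "0 \<le> v 0" "v 0 \<le> 1"
      proof -
        have "- 1 < v 0" "- 1 < k (v 0)"
          using that(1) k_nonneg[of "v 0"] by (auto intro: less_le_trans[of "- 1" 0])
        moreover have "v 0 < k 1 + 2" "k (v 0) < k 1 + 2"
          using that(2) k_nonneg[of 1] k_mono[OF that(2)]
          by (auto intro: le_less_trans[of _ 1] le_less_trans[of _ "k 1"] add_nonneg_pos)
        ultimately show ?thesis by simp
      qed
      then show ?thesis unfolding P_def l_def by blast
    qed
    ultimately have "definable_pred M (\<lambda>v. 0 \<le> v 0 \<and> v 0 \<le> 1 \<and> v 1 = l (v 0))"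
      by (rule definable_pred_cong)
    moreover have "(\<lambda>x. x(1 := l (x 0))) ` {x \<in> cart 1. x 0 \<in> {0..1}} =
        {y \<in> cart (Suc 1). 0 \<le> y 0 \<and> y 0 \<le> 1 \<and> y 1 = l (y 0)}"
      by (subst definable_map_graph) auto
    ultimately show "definable_map1 M {0..1} l"
      unfolding definable_map1_def definable_map_def definable_iff_definable_pred by blast
    show "continuous_on {0..1} l"
    proof (rule lipschitz_continuous_on)
      fix s t :: 'a assume "s \<in> {0..1}" "t \<in> {0..1}"
      then show "\<bar>l s - l t\<bar> \<le> (k 1 + 1) * \<bar>s - t\<bar>"
        using l_lip[of s t] l_lip[of t s] by (cases "s \<le> t") (auto simp: abs_minus_commute)
    qed
    show "strict_mono_on {0..1} l"
      using l_less by (auto intro!: strict_mono_onI)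
    show "l 0 = 0" by (simp add: l_def)
  qed
  moreover have "l \<bar>g x\<bar> \<le> \<bar>f x\<bar>" if "x \<in> S" "\<bar>g x\<bar> \<le> 1" for x
  proof -
    have "l \<bar>g x\<bar> \<le> 1 * k \<bar>g x\<bar>" unfolding l_def using that k_nonneg by (intro mult_right_mono)
    also have "\<dots> \<le> \<bar>f x\<bar>" using k_le that by simp
    finally show ?thesis .
  qed
  \<comment> \<open>The witness is \<open>k \<delta>\<close>.\<close>
  moreover have "\<exists>c>0. \<forall>x\<in>S. \<delta> \<le> \<bar>g x\<bar> \<longrightarrow> c \<le> \<bar>f x\<bar>" if "0 < \<delta>" for \<delta>
    using k_le k_pos[OF that] by blast
  ultimately show thesis by (rule that)
qed

text \<open>Where \<open>g\<close> is small, \<open>w\<close> lies below \<open>l\<close> and the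
  factor 1 suffices. Elsewhere \<open>w\<close> is at most \<open>W\<close> and
  \<open>\<bar>f x\<bar>\<close> at least \<open>c\<close>, so \<open>W / c\<close> does. Both
  conclusions of the theorem are instances.\<close>

lemma dominated_by_multiple:
  fixes f g :: "'b \<Rightarrow> 'a::{linordered_field, linorder_topology}"
  assumes near: "\<And>x. x \<in> S \<Longrightarrow> \<bar>g x\<bar> \<le> 1 \<Longrightarrow> l \<bar>g x\<bar> \<le> \<bar>f x\<bar>"
    and far: "\<And>\<delta>. 0 < \<delta> \<Longrightarrow> \<exists>c>0. \<forall>x\<in>S. \<delta> \<le> \<bar>g x\<bar> \<longrightarrow> c \<le> \<bar>f x\<bar>"
    and w: "\<forall>\<^sub>F t in at_right 0. w t \<le> l t" "w 0 = 0" "\<And>x. x \<in> S \<Longrightarrow> w \<bar>g x\<bar> \<le> W"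
  shows "\<exists>N>0. \<forall>x\<in>S. w \<bar>g x\<bar> \<le> N * \<bar>f x\<bar>"
proof -
  obtain b where b: "0 < b" "\<And>t. 0 < t \<Longrightarrow> t < b \<Longrightarrow> w t \<le> l t"
    using w(1) unfolding eventually_at_right[OF zero_less_one] by blast
  obtain c where c: "0 < c" "\<And>x. x \<in> S \<Longrightarrow> min b 1 \<le> \<bar>g x\<bar> \<Longrightarrow> c \<le> \<bar>f x\<bar>"
    using far[of "min b 1"] b(1) by auto
  have "w \<bar>g x\<bar> \<le> max 1 (W / c) * \<bar>f x\<bar>" if x: "x \<in> S" for x
  proof (cases "\<bar>g x\<bar> < min b 1")
    case True
    have "w \<bar>g x\<bar> \<le> \<bar>f x\<bar>"
    \<comment> \<open>The eventual bound concerns positive arguments only; at zeros of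
      \<open>g\<close> the condition \<open>w 0 = 0\<close> takes over.\<close>
    proof (cases "g x = 0")
      case False
      then have "w \<bar>g x\<bar> \<le> l \<bar>g x\<bar>" using True by (intro b(2)) simp_all
      also have "\<dots> \<le> \<bar>f x\<bar>" using True by (intro near x) simp
      finally show ?thesis .
    qed (simp add: w(2))
    also have "\<dots> \<le> max 1 (W / c) * \<bar>f x\<bar>"
      using mult_right_mono[of 1 "max 1 (W / c)" "\<bar>f x\<bar>"] by simp
    finally show ?thesis .
  next
    case False
    then have "c \<le> \<bar>f x\<bar>" by (intro c(2) x) (rule leI)
    have "w \<bar>g x\<bar> \<le> W / c * c" using w(3)[OF x] c(1) by simp
    also have "\<dots> \<le> max 1 (W / c) * c" using c(1) by (intro mult_right_mono) auto
    also have "\<dots> \<le> max 1 (W / c) * \<bar>f x\<bar>" using \<open>c \<le> \<bar>f x\<bar>\<close> by (intro mult_left_mono) auto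
    finally show ?thesis .
  qed
  then show ?thesis by (intro exI[of _ "max 1 (W / c)"]) auto
qed

theorem proposition4p5:
  fixes M :: "('a::{linordered_field, linorder_topology}, 'f, 'r) expansion"
    and \<Phi> :: "('a \<Rightarrow> 'a) set"
    and n :: nat
    and S :: "(nat \<Rightarrow> 'a) set"
    and f g :: "(nat \<Rightarrow> 'a) \<Rightarrow> 'a"
  assumes "definably_complete M"
    and "locally_o_minimal M"
    and "definable_bounded_mult M"
    and "admissible M \<Phi>"
    and "definable M n S"
    and "closedin (cart_topology n) S"
    and "bounded_cart n S"
    and "definable_map M n S f"
    and "continuous_map (subtopology (cart_topology n) S) euclidean f"
    and "definable_map M n S g"
    and "continuous_map (subtopology (cart_topology n) S) euclidean g"
    and "{x \<in> S. f x = 0} \<subseteq> {x \<in> S. g x = 0}"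
  shows "(\<exists>\<phi>\<in>\<Phi>. \<exists>N>0. \<forall>x\<in>S. \<bar>\<phi> (g x)\<bar> \<le> N * \<bar>f x\<bar>) \<and>
    (polynomially_bounded M \<longrightarrow>
      (\<exists>m::nat. 0 < m \<and> (\<exists>N>0. \<forall>x\<in>S. \<bar>g x\<bar> ^ m \<le> N * \<bar>f x\<bar>)))"
proof (cases "S = {}")
  case True
  \<comment> \<open>On the empty set any element of the group serves.\<close>
  have "id \<in> \<Phi>"
    using assms(4) subgroup.one_closed[of \<Phi> "Phi0_group M"]
    by (simp add: admissible_def Phi0_group_def)
  then show ?thesis using True zero_less_one by blast
next
  case False
  have S: "S \<subseteq> cart n" using assms(5) unfolding definable_def by blast
  define f' where "f' x = (if x \<in> S then f x else 0)" for x
  define g' where "g' x = (if x \<in> S then g x else 0)" for x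
  have f': "definable_fun M (\<lambda>v. f' (restrict v {..<n}))" "box_continuous n S f'"
    using definable_fun_map[OF assms(8,5)] box_continuous_continuous_map[OF assms(9) S]
      box_continuous_cong[of S f' f n]
    by (simp_all add: f'_def)
  have g': "definable_fun M (\<lambda>v. g' (restrict v {..<n}))" "box_continuous n S g'"
    using definable_fun_map[OF assms(10,5)] box_continuous_continuous_map[OF assms(11) S]
      box_continuous_cong[of S g' g n]
    by (simp_all add: g'_def)
  have zeros: "g' x = 0" if "x \<in> S" "f' x = 0" for x
    using that assms(12) by (auto simp: f'_def g'_def)
  obtain l where l: "definable_increasing M 1 l"
    and near: "\<And>x. x \<in> S \<Longrightarrow> \<bar>g' x\<bar> \<le> 1 \<Longrightarrow> l \<bar>g' x\<bar> \<le> \<bar>f' x\<bar>"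
    and far: "\<And>\<delta>. 0 < \<delta> \<Longrightarrow> \<exists>c>0. \<forall>x\<in>S. \<delta> \<le> \<bar>g' x\<bar> \<longrightarrow> c \<le> \<bar>f' x\<bar>"
    by (rule lojasiewicz_gauge[OF assms(1,3,5,6,7) False f' g' zeros]) (assumption | rule that)+
  have "definable_fun M (\<lambda>v. \<bar>g' (restrict v {..<n})\<bar>)"
    using g'(1) by (rule definable_fun_abs)
  moreover have "box_continuous n S (\<lambda>x. \<bar>g' x\<bar>)"
    using g'(2) abs_triangle_ineq3 by (rule box_continuous_nonexpansive)
  \<comment> \<open>A point where \<open>\<bar>g'\<bar>\<close> is maximal; it bounds
    \<open>w \<bar>g' x\<bar>\<close> for each of the monotone \<open>w\<close> used below.\<close>
  ultimately obtain c where c: "\<And>x. x \<in> S \<Longrightarrow> \<bar>g' x\<bar> \<le> \<bar>g' c\<bar>"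
    using definable_attains_sup[OF assms(1,5,6,7) False, of "\<lambda>x. \<bar>g' x\<bar>"] by blast
  have eq: "f' x = f x" "g' x = g x" if "x \<in> S" for x
    using that by (simp_all add: f'_def g'_def)
  have dominated: "\<exists>N>0. \<forall>x\<in>S. w \<bar>g' x\<bar> \<le> N * \<bar>f' x\<bar>"
    if "\<forall>\<^sub>F t in at_right 0. w t \<le> l t" "w 0 = 0" "\<And>x. x \<in> S \<Longrightarrow> w \<bar>g' x\<bar> \<le> w \<bar>g' c\<bar>" for w
    using near far that by (rule dominated_by_multiple)
  show ?thesis
  proof (intro conjI impI)
    \<comment> \<open>The required element of the group is the one that admissibility places below
      \<open>l\<close> near 0.\<close>
    obtain \<psi> where \<psi>: "\<psi> \<in> \<Phi>" and le: "\<forall>\<^sub>F t in at_right 0. \<psi> t \<le> l t"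
    proof -
      obtain \<phi> \<psi> where "\<psi> \<in> \<Phi>" "\<forall>\<^sub>F t in at_right 0. l t \<le> \<phi> t \<and> \<psi> t \<le> l t"
        using assms(4) l zero_less_one unfolding admissible_def by blast
      then show thesis by (intro that[of \<psi>]) (auto elim: eventually_mono)
    qed
    have "\<psi> \<in> Phi0 M"
      using assms(4) \<psi> subgroup.subset[of \<Phi> "Phi0_group M"]
      by (auto simp: admissible_def Phi0_group_def)
    then have odd: "\<psi> (- x) = - \<psi> x" and \<psi>0: "\<psi> 0 = 0" and mono: "strict_mono \<psi>" for x
      unfolding Phi0_def by auto
    have "\<psi> \<bar>g' x\<bar> \<le> \<psi> \<bar>g' c\<bar>" if "x \<in> S" for x
      using mono c[OF that] by (simp add: strict_mono_less_eq)
    then obtain N where N: "0 < N" "\<forall>x\<in>S. \<psi> \<bar>g' x\<bar> \<le> N * \<bar>f' x\<bar>"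
      using dominated[of \<psi>, OF le \<psi>0] by blast
    \<comment> \<open>Oddness and monotonicity carry the estimate from
      \<open>\<bar>g x\<bar>\<close> over to the signed value \<open>g x\<close>.\<close>
    have "\<bar>\<psi> a\<bar> = \<psi> \<bar>a\<bar>" for a
      using strict_mono_less_eq[OF mono, of 0 a] strict_mono_less_eq[OF mono, of a 0]
      by (cases "0 \<le> a") (auto simp: \<psi>0 odd abs_of_neg)
    then have "\<forall>x\<in>S. \<bar>\<psi> (g x)\<bar> \<le> N * \<bar>f x\<bar>" using N(2) eq by simp
    then show "\<exists>\<phi>\<in>\<Phi>. \<exists>N>0. \<forall>x\<in>S. \<bar>\<phi> (g x)\<bar> \<le> N * \<bar>f x\<bar>"
      using \<psi> N(1) by blast
  next
    assume "polynomially_bounded M"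
    then obtain m where m: "0 < m" "\<forall>\<^sub>F t in at_right 0. t ^ m \<le> l t"
      using l zero_less_one unfolding polynomially_bounded_def by blast
    have "\<bar>g' x\<bar> ^ m \<le> \<bar>g' c\<bar> ^ m" if "x \<in> S" for x
      using c[OF that] by (intro power_mono) auto
    \<comment> \<open>Positivity of \<open>m\<close> makes the power vanish at 0.\<close>
    then obtain N where "0 < N" "\<forall>x\<in>S. \<bar>g' x\<bar> ^ m \<le> N * \<bar>f' x\<bar>"
      using dominated[of "\<lambda>t. t ^ m", OF m(2)] m(1) by auto
    then show "\<exists>m. 0 < m \<and> (\<exists>N>0. \<forall>x\<in>S. \<bar>g x\<bar> ^ m \<le> N * \<bar>f x\<bar>)"
      using m(1) eq by auto
  qed
qed

end
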